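(* Let $m,r\ge 2$ and let $T=T_1\cdot T_2\cdots T_m$ and $S=S_1\cdot S_2\cdots S_r$ in $\mathbb{P}$, where $T_i\in\mathbb{P}\setminus\{\underline{1}\}$ for $1\le i\le m$ and $S_j\in\mathbb{P}\setminus\{\underline{1}\}$ for $1\le j\le r$. Then $$\binom{T}{S}=\sum_{1\le i_1<i_2<\dots<i_r\le m}\binom{T_{i_1}}{S_1}\cdots\binom{T_{i_r}}{S_r}+\sum_{i=1}^m\binom{T_i}{S}.$$
   Context: $\mathbb{P}$ is the set of isomorphism classes of finite planar reduced rooted trees: finite rooted trees in which the children of every vertex are linearly ordered and no vertex has exactly one child (isomorphisms preserve root and orders). The empty tree $\underline{1}$ (no vertices) is included in $\mathbb{P}$. $L(T)$ is the set of leaves (vertices without children) of $T$. Grafting: for $m\ge 2$ and nonempty $T_1,\dots,T_m\in\mathbb{P}$, $T_1\cdot T_2\cdots T_m=\cdot_m(T_1,\dots,T_m)$ is the tree whose root has exactly $m$ children, which are, in order, the roots of $T_1,\dots,T_m$ (so removing the root leaves the ordered planar forest $T_1,\dots,T_m$). This is a single $m$-ary operation, not an iterated binary product. Contraction: for $I\subseteq L(T)$, $T|I$ is the tree in $\mathbb{P}$ obtained as follows. If $I=\emptyset$, then $T|I=\underline{1}$. Otherwise keep exactly the vertices of $T$ lying on a path from the root to a leaf in $I$, with the inherited planar order, and then suppress every vertex having exactly one child (if the root has exactly one child, delete it and let the child be the new root, repeatedly). Planar binomial coefficient (first kind): for $T,S\in\mathbb{P}$, $\binom{T}{S}$ is the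 number of subsets $I\subseteq L(T)$ such that $T|I$ is isomorphic to $S$. *)

theory Defs
  imports Complex_Main "HOL-Library.Sublist" "HOL-Library.FuncSet"
begin

text \<open>
  Nonempty finite planar rooted trees up to isomorphism: a tree is determined by the
  ordered list of the subtrees at the children of its root, so equality of values is
  isomorphism. The empty tree is the value \<open>None\<close> of the option type.
\<close>

datatype ptree = Node "ptree list"

lemma size_nth_less [termination_simp]:
  "i < length ts \<Longrightarrow> size (ts ! i) < Suc (size_list size ts)"
  by (metis less_Suc_eq_le nth_mem order_refl size_list_estimation')

fun reduced :: "ptree \<Rightarrow> bool" where
  "reduced (Node ts) \<longleftrightarrow> length ts \<noteq> 1 \<and> (\<forall>t\<in>set ts. reduced t)"

abbreviation empty_tree :: "ptree option" where
  "empty_tree \<equiv> None"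

definition planar_trees :: "ptree option set" where
  "planar_trees = {empty_tree} \<union> Some ` {t. reduced t}"

text \<open>
  A vertex is addressed by the sequence of child indices (from 0) on the path from the
  root to it; the ancestors of a vertex are the prefixes of its address.
\<close>

fun vertices :: "ptree \<Rightarrow> nat list set" where
  "vertices (Node ts) = insert [] (\<Union>i<length ts. (#) i ` vertices (ts ! i))"

definition tree_leaves :: "ptree \<Rightarrow> nat list set" where
  "tree_leaves t = {p \<in> vertices t. \<forall>i. p @ [i] \<notin> vertices t}"

fun leaves :: "ptree option \<Rightarrow> nat list set" where
  "leaves None = {}"
| "leaves (Some t) = tree_leaves t"

text \<open>Only meaningful for nonempty argument trees.\<close>

definition graft :: "ptree option list \<Rightarrow> ptree option" where
  "graft Ts = Some (Node (map the Ts))"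

definition spanned_vertices :: "ptree \<Rightarrow> nat list set \<Rightarrow> nat list set" where
  "spanned_vertices t I = {p \<in> vertices t. \<exists>q\<in>I. prefix p q}"

text \<open>
  The planar subtree of \<open>t\<close> on a vertex set \<open>V\<close>, where \<open>V\<close> is closed under taking
  parents and contains the root.
\<close>

fun induced_subtree :: "nat list set \<Rightarrow> ptree \<Rightarrow> ptree" where
  "induced_subtree V (Node ts) =
     Node (map (\<lambda>i. induced_subtree {p. i # p \<in> V} (ts ! i))
               (filter (\<lambda>i. [i] \<in> V) [0..<length ts]))"

fun suppress_unary :: "ptree \<Rightarrow> ptree" where
  "suppress_unary (Node [t]) = suppress_unary t"
| "suppress_unary (Node ts) = Node (map suppress_unary ts)"

fun contract :: "ptree option \<Rightarrow> nat list set \<Rightarrow> ptree option" where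
  "contract None I = empty_tree"
| "contract (Some t) I =
     (if I = {} then empty_tree
      else Some (suppress_unary (induced_subtree (spanned_vertices t I) t)))"

definition pbinom :: "ptree option \<Rightarrow> ptree option \<Rightarrow> nat" where
  "pbinom T S = card {I. I \<subseteq> leaves T \<and> contract T I = S}"

lemma finite_vertices: "finite (vertices t)"
  by (induction t rule: vertices.induct) auto

lemma finite_leaves: "finite (leaves T)"
  by (cases T) (auto simp: tree_leaves_def finite_vertices)

lemma reduced_suppress_unary: "reduced (suppress_unary t)"
  by (induction t rule: suppress_unary.induct) auto

lemma contract_in_planar_trees: "contract T I \<in> planar_trees"
  by (cases T) (auto simp: planar_trees_def reduced_suppress_unary)

end

theory Submission
  imports Defs
begin

text \<open>
  A set \<open>I\<close> of leaves of a grafted tree is a family of leaf sets, one for each child of the root.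
  Only the children with nonempty leaf set survive in the contraction: if there is just one, the
  root is suppressed and the contraction takes place inside that child; if there are at least two,
  the root survives and the surviving children are contracted independently of each other. The two
  cases give the two sums.
\<close>

section \<open>Branches of a set of leaf addresses\<close>

definition branch :: "nat list set \<Rightarrow> nat \<Rightarrow> nat list set" where
  "branch I k = {p. k # p \<in> I}"

definition branch_support :: "nat list set \<Rightarrow> nat set" where
  "branch_support I = {k. branch I k \<noteq> {}}"

lemma root_in_vertices: "[] \<in> vertices t"
  by (cases t) simp

lemma Cons_in_vertices_Node:
  "k # p \<in> vertices (Node ts) \<longleftrightarrow> k < length ts \<and> p \<in> vertices (ts ! k)"
  by auto

lemma Cons_in_tree_leaves_Node:
  "k # p \<in> tree_leaves (Node ts) \<longleftrightarrow> k < length ts \<and> p \<in> tree_leaves (ts ! k)"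
  by (auto simp: tree_leaves_def simp del: vertices.simps simp: Cons_in_vertices_Node)

lemma root_notin_tree_leaves_Node:
  assumes "ts \<noteq> []"
  shows "[] \<notin> tree_leaves (Node ts)"
proof -
  have "[] @ [0] \<in> vertices (Node ts)"
    using assms root_in_vertices by (simp only: append_Nil Cons_in_vertices_Node) simp
  then show ?thesis
    unfolding tree_leaves_def by blast
qed

text \<open>With at least one child the root is not a leaf, and an address \<open>k # p\<close> is a
  leaf exactly when \<open>p\<close> is a leaf of child \<open>k\<close>. This form lets a leaf set
  be both taken apart into branches and certified after being assembled from them.\<close>

lemma subset_tree_leaves_Node_iff:
  assumes "ts \<noteq> []"
  shows "I \<subseteq> tree_leaves (Node ts) \<longleftrightarrow>
    [] \<notin> I \<and> branch_support I \<subseteq> {..<length ts} \<and>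
    (\<forall>k \<in> branch_support I. branch I k \<subseteq> tree_leaves (ts ! k))"
    (is "?L \<longleftrightarrow> ?R")
proof
  assume ?L
  then show ?R
    using root_notin_tree_leaves_Node[OF assms] Cons_in_tree_leaves_Node
    unfolding branch_support_def branch_def by blast
next
  assume R: ?R
  show ?L
  proof
    fix p assume "p \<in> I"
    with R show "p \<in> tree_leaves (Node ts)"
      by (cases p) (auto simp: Cons_in_tree_leaves_Node branch_support_def branch_def)
  qed
qed

text \<open>The branches of a set of addresses forget only whether the root address
  \<open>[]\<close> belongs to it.\<close>

lemma leaf_set_eqI:
  assumes "[] \<notin> I" "[] \<notin> J" "\<And>k. branch I k = branch J k"
  shows "I = J"
proof (rule set_eqI)
  fix p show "p \<in> I \<longleftrightarrow> p \<in> J"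
    using assms by (cases p) (auto simp: branch_def set_eq_iff)
qed

lemma finite_branch_support:
  assumes "ts \<noteq> []" "I \<subseteq> tree_leaves (Node ts)"
  shows "finite (branch_support I)"
  using assms subset_tree_leaves_Node_iff[of ts I] finite_subset[of _ "{..<length ts}"] by simp

section \<open>Contraction of a grafted tree\<close>

lemma branch_spanned_vertices:
  assumes "k < length ts"
  shows "{p. k # p \<in> spanned_vertices (Node ts) I} = spanned_vertices (ts ! k) (branch I k)"
proof -
  have "(\<exists>q\<in>I. prefix (k # p) q) \<longleftrightarrow> (\<exists>q\<in>branch I k. prefix p q)" for p
    by (auto simp: branch_def prefix_def)
  then show ?thesis
    using assms by (auto simp: spanned_vertices_def Cons_in_vertices_Node simp del: vertices.simps)
qed

lemma child_in_spanned_vertices_iff: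
  assumes "k < length ts"
  shows "[k] \<in> spanned_vertices (Node ts) I \<longleftrightarrow> k \<in> branch_support I"
proof -
  have "[k] \<in> spanned_vertices (Node ts) I \<longleftrightarrow> [] \<in> spanned_vertices (ts ! k) (branch I k)"
    using branch_spanned_vertices[OF assms, of I] by blast
  then show ?thesis
    by (auto simp: spanned_vertices_def branch_support_def root_in_vertices)
qed

text \<open>Pattern matching splits the second equation of \<open>suppress_unary\<close> into no
  child and at least two children; this reunites the two cases.\<close>

lemma suppress_unary_Node:
  "length ts \<noteq> 1 \<Longrightarrow> suppress_unary (Node ts) = Node (map suppress_unary ts)"
  by (cases ts rule: list.exhaust; cases "tl ts") auto

text \<open>Before suppression, the root keeps exactly the children listed in \<open>ks\<close>, in
  their old order, so \<open>length ks\<close> decides whether it survives. The use of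
  \<open>the\<close> is harmless: branches over \<open>ks\<close> are nonempty, hence contract to
  nonempty trees.\<close>

lemma contract_Node:
  assumes "ts \<noteq> []" "I \<subseteq> tree_leaves (Node ts)"
    and ks: "sorted_wrt (<) ks" "branch_support I = set ks"
  shows "contract (Some (Node ts)) I =
    (if ks = [] then None
     else if length ks = 1 then contract (Some (ts ! hd ks)) (branch I (hd ks))
     else Some (Node (map (\<lambda>k. the (contract (Some (ts ! k)) (branch I k))) ks)))"
proof -
  let ?V = "spanned_vertices (Node ts) I"
  let ?f = "\<lambda>k. induced_subtree (spanned_vertices (ts ! k) (branch I k)) (ts ! k)"
  have R: "[] \<notin> I" "set ks \<subseteq> {..<length ts}"
    using subset_tree_leaves_Node_iff[OF assms(1)] assms(2) ks(2) by auto
  \<comment> \<open>Both lists are strictly increasing, so it is enough to compare their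
    sets.\<close>
  have "filter (\<lambda>k. [k] \<in> ?V) [0..<length ts] = ks"
  proof (rule strict_sorted_equal)
    show "sorted_wrt (<) (filter (\<lambda>k. [k] \<in> ?V) [0..<length ts])"
      by (intro sorted_wrt_filter) simp
    show "set (filter (\<lambda>k. [k] \<in> ?V) [0..<length ts]) = set ks"
      using R(2) ks(2) child_in_spanned_vertices_iff by auto
  qed (fact ks(1))
  \<comment> \<open>The set \<open>{p. k # p \<in> ?V}\<close> handed down by
    \<open>induced_subtree\<close> is the vertex set spanned by \<open>branch I k\<close> in child
    \<open>k\<close>, so each surviving child is treated as in its own contraction.\<close>
  then have induced: "induced_subtree ?V (Node ts) = Node (map ?f ks)"
    using R(2) branch_spanned_vertices[of _ ts I] by auto
  have c: "contract (Some (ts ! k)) (branch I k) = Some (suppress_unary (?f k))" if "k \<in> set ks" for k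
    using that ks(2) unfolding branch_support_def by auto
  have "I = {} \<longleftrightarrow> branch_support I = {}"
  proof
    assume "branch_support I = {}"
    then have "k # p \<notin> I" for k p
      by (auto simp: branch_support_def branch_def)
    with R(1) show "I = {}"
      by (metis equals0I list.exhaust)
  qed (auto simp: branch_support_def branch_def)
  then have empty: "I = {} \<longleftrightarrow> ks = []"
    using ks(2) by simp
  consider "ks = []" | k where "ks = [k]" | "ks \<noteq> []" "length ks \<noteq> 1"
    by (metis One_nat_def length_0_conv length_Suc_conv)
  then show ?thesis
  proof cases
    case 1
    then show ?thesis using empty by simp
  next
    case 2
    then show ?thesis using empty induced c[of k] by simp
  next
    case 3
    then show ?thesis
      using empty induced c suppress_unary_Node[of "map ?f ks"] by (simp add: comp_def)
  qed
qed

text \<open>Such a leaf set amounts to an independent choice of one branch in \<open>X k\<close> for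
  each \<open>k\<close> in \<open>K\<close>. Excluding the empty set from every \<open>X k\<close>
  makes the support of an assembled family all of \<open>K\<close>, not just a part of it.\<close>

lemma card_leaf_sets_by_branches:
  assumes "ts \<noteq> []" "K \<subseteq> {..<length ts}"
    and X: "\<And>k. k \<in> K \<Longrightarrow> X k \<subseteq> Pow (tree_leaves (ts ! k)) - {{}}"
  shows "card {I. I \<subseteq> tree_leaves (Node ts) \<and> branch_support I = K \<and> (\<forall>k\<in>K. branch I k \<in> X k)}
    = (\<Prod>k\<in>K. card (X k))"
proof -
  let ?A = "{I. I \<subseteq> tree_leaves (Node ts) \<and> branch_support I = K \<and> (\<forall>k\<in>K. branch I k \<in> X k)}"
  let ?join = "\<lambda>F. \<Union>k\<in>K. (#) k ` F k"
  have fin: "finite K"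
    using assms(2) finite_subset by blast
  have branch_join: "branch (?join F) k = (if k \<in> K then F k else {})" for F k
    by (auto simp: branch_def)
  \<comment> \<open>Elements of \<open>PiE K X\<close> are \<open>undefined\<close> outside
    \<open>K\<close>, hence \<open>restrict\<close>. The inverse \<open>?join\<close> puts
    \<open>k\<close> in front of every address in \<open>F k\<close> and collects the
    results.\<close>
  have "bij_betw (\<lambda>I. restrict (branch I) K) ?A (PiE K X)"
  proof (rule bij_betw_byWitness[where f' = ?join])
    show "\<forall>I\<in>?A. ?join (restrict (branch I) K) = I"
    proof
      fix I assume I: "I \<in> ?A"
      show "?join (restrict (branch I) K) = I"
      proof (rule leaf_set_eqI)
        show "[] \<notin> I"
          using I subset_tree_leaves_Node_iff[OF assms(1)] by blast
        show "branch (?join (restrict (branch I) K)) k = branch I k" for k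
          unfolding branch_join using I by (auto simp: branch_support_def)
      qed auto
    qed
    show "\<forall>F\<in>PiE K X. restrict (branch (?join F)) K = F"
      by (auto simp: branch_join PiE_def extensional_def fun_eq_iff)
    show "(\<lambda>I. restrict (branch I) K) ` ?A \<subseteq> PiE K X"
      by auto
    show "?join ` PiE K X \<subseteq> ?A"
    proof
      fix I assume "I \<in> ?join ` PiE K X"
      then obtain F where F: "F \<in> PiE K X" "I = ?join F" by blast
      have b: "branch I k = (if k \<in> K then F k else {})" for k
        unfolding F(2) by (rule branch_join)
      have FX: "F k \<in> X k" if "k \<in> K" for k
        using F(1) that by auto
      have supp: "branch_support I = K"
        using FX X by (auto simp: branch_support_def b)
      have "I \<subseteq> tree_leaves (Node ts)"
        unfolding subset_tree_leaves_Node_iff[OF assms(1)] supp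
      proof (intro conjI ballI)
        show "[] \<notin> I" unfolding F(2) by blast
        show "branch I k \<subseteq> tree_leaves (ts ! k)" if "k \<in> K" for k
          using FX[OF that] X[OF that] that by (auto simp: b)
      qed (fact assms(2))
      then show "I \<in> ?A"
        using supp FX by (simp add: b)
    qed
  qed
  then have "card ?A = card (PiE K X)"
    by (rule bij_betw_same_card)
  then show ?thesis
    by (simp add: card_PiE[OF fin])
qed

section \<open>The recursion for trees given by lists of children, with indices from 0\<close>

definition increasing_indices :: "nat \<Rightarrow> nat \<Rightarrow> nat list set" where
  "increasing_indices m r = {ks. sorted_wrt (<) ks \<and> set ks \<subseteq> {..<m} \<and> length ks = r}"

lemma finite_increasing_indices: "finite (increasing_indices m r)"
  by (rule finite_subset[OF _ finite_lists_length_eq[of "{..<m}" r]])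
    (auto simp: increasing_indices_def)

lemma pbinom_Some_eq:
  "pbinom (Some t) S = card {I. I \<subseteq> tree_leaves t \<and> contract (Some t) I = S}"
  unfolding pbinom_def by simp

lemma finite_leaf_sets: "finite {I. I \<subseteq> tree_leaves t \<and> P I}"
  by (rule finite_subset[of _ "Pow (tree_leaves t)"]) (use finite_leaves[of "Some t"] in auto)

proposition pbinom_Node_Node:
  assumes ts: "ts \<noteq> []" and ss: "length ss \<ge> 2"
  shows "pbinom (Some (Node ts)) (Some (Node ss)) =
    (\<Sum>ks \<in> increasing_indices (length ts) (length ss).
       \<Prod>j<length ss. pbinom (Some (ts ! (ks ! j))) (Some (ss ! j)))
    + (\<Sum>k<length ts. pbinom (Some (ts ! k)) (Some (Node ss)))"
proof -
  let ?m = "length ts" and ?r = "length ss"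
  let ?c = "\<lambda>I k. contract (Some (ts ! k)) (branch I k)"
  let ?E = "{I. I \<subseteq> tree_leaves (Node ts) \<and> contract (Some (Node ts)) I = Some (Node ss)}"
  \<comment> \<open>The families \<open>A\<close> and \<open>B\<close> split \<open>?E\<close>: in
    \<open>A ks\<close> the root survives with children \<open>ks\<close>, in \<open>B k\<close> it
    is suppressed in favour of child \<open>k\<close>.\<close>
  define A where "A ks = {I. I \<subseteq> tree_leaves (Node ts) \<and> branch_support I = set ks
      \<and> (\<forall>j<?r. ?c I (ks ! j) = Some (ss ! j))}" for ks
  define B where "B k = {I. I \<subseteq> tree_leaves (Node ts) \<and> branch_support I = {k}
      \<and> ?c I k = Some (Node ss)}" for k
  define X where "X t s = {J. J \<subseteq> tree_leaves t \<and> contract (Some t) J = Some s}" for t s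
  have card_X: "card (X t s) = pbinom (Some t) (Some s)" for t s
    by (simp only: X_def pbinom_Some_eq)
  \<comment> \<open>The empty leaf set contracts to \<open>None\<close>, so it never lies in
    \<open>X t s\<close>.\<close>
  have X_subset: "X t s \<subseteq> Pow (tree_leaves t) - {{}}" for t s
    by (auto simp: X_def)
  have branch_leaves: "branch I k \<subseteq> tree_leaves (ts ! k)"
    if "I \<subseteq> tree_leaves (Node ts)" "k \<in> branch_support I" for I k
    using that subset_tree_leaves_Node_iff[OF ts, of I] by simp
  have finA: "finite (A ks)" and finB: "finite (B k)" for ks k
    unfolding A_def B_def by (rule finite_leaf_sets)+
  have card_A: "card (A ks) = (\<Prod>j<?r. pbinom (Some (ts ! (ks ! j))) (Some (ss ! j)))"
    if ks: "ks \<in> increasing_indices ?m ?r" for ks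
  proof -
    have len: "length ks = ?r" and sub: "set ks \<subseteq> {..<?m}" and dist: "distinct ks"
      using ks by (auto simp: increasing_indices_def strict_sorted_iff)
    have bij: "bij_betw ((!) ks) {..<?r} (set ks)"
      using dist len by (intro bij_betw_nth) auto
    \<comment> \<open>\<open>pos k\<close> is the position of \<open>k\<close> in \<open>ks\<close>.
      It turns conditions indexed by \<open>j\<close> into conditions indexed by the child
      \<open>k\<close>, as the counting lemma requires.\<close>
    define pos where "pos = the_inv_into {..<?r} ((!) ks)"
    have pos: "pos (ks ! j) = j" if "j < ?r" for j
      using that bij unfolding pos_def by (auto simp: bij_betw_def the_inv_into_f_f)
    have set_ks: "set ks = (!) ks ` {..<?r}"
      using bij by (simp add: bij_betw_def)
    have "A ks = {I. I \<subseteq> tree_leaves (Node ts) \<and> branch_support I = set ks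
      \<and> (\<forall>k\<in>set ks. branch I k \<in> X (ts ! k) (ss ! pos k))}"
      unfolding A_def
    proof (intro Collect_cong conj_cong refl)
      fix I assume I: "I \<subseteq> tree_leaves (Node ts)" "branch_support I = set ks"
      have "branch I (ks ! j) \<subseteq> tree_leaves (ts ! (ks ! j))" if "j < ?r" for j
        using that len I by (intro branch_leaves) simp_all
      then have "branch I (ks ! j) \<in> X (ts ! (ks ! j)) (ss ! pos (ks ! j)) \<longleftrightarrow>
          ?c I (ks ! j) = Some (ss ! j)" if "j < ?r" for j
        using that unfolding X_def by (simp add: pos del: contract.simps)
      then show "(\<forall>j<?r. ?c I (ks ! j) = Some (ss ! j)) \<longleftrightarrow>
          (\<forall>k\<in>set ks. branch I k \<in> X (ts ! k) (ss ! pos k))"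
        unfolding set_ks ball_simps by blast
    qed
    then have "card (A ks) = (\<Prod>k\<in>set ks. pbinom (Some (ts ! k)) (Some (ss ! pos k)))"
      using card_leaf_sets_by_branches[OF ts sub, of "\<lambda>k. X (ts ! k) (ss ! pos k)"] X_subset
      by (simp add: card_X)
    also have "\<dots> = (\<Prod>j<?r. pbinom (Some (ts ! (ks ! j))) (Some (ss ! j)))"
      by (subst prod.reindex_bij_betw[OF bij, symmetric]) (simp add: pos)
    finally show ?thesis .
  qed
  have card_B: "card (B k) = pbinom (Some (ts ! k)) (Some (Node ss))" if "k < ?m" for k
  proof -
    have "B k = {I. I \<subseteq> tree_leaves (Node ts) \<and> branch_support I = {k}
      \<and> (\<forall>k\<in>{k}. branch I k \<in> X (ts ! k) (Node ss))}"
      unfolding B_def X_def using branch_leaves by blast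
    then show ?thesis
      using card_leaf_sets_by_branches[OF ts, of "{k}" "\<lambda>k. X (ts ! k) (Node ss)"] that X_subset
      by (simp add: card_X)
  qed
  have E_eq: "?E = (\<Union>ks\<in>increasing_indices ?m ?r. A ks) \<union> (\<Union>k<?m. B k)"
  proof (intro set_eqI)
    fix I
    show "I \<in> ?E \<longleftrightarrow> I \<in> (\<Union>ks\<in>increasing_indices ?m ?r. A ks) \<union> (\<Union>k<?m. B k)"
    proof (cases "I \<subseteq> tree_leaves (Node ts)")
      case False
      then show ?thesis by (auto simp: A_def B_def)
    next
      case I: True
      \<comment> \<open>The strictly increasing list of the support is the only list
        \<open>ls\<close> of \<open>increasing_indices ?m ?r\<close> for which \<open>I\<close> can
        lie in \<open>A ls\<close>.\<close>
      define ks where "ks = sorted_list_of_set (branch_support I)"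
      have ks: "sorted_wrt (<) ks" "branch_support I = set ks"
        using finite_branch_support[OF ts I] by (simp_all add: ks_def)
      have sub: "set ks \<subseteq> {..<?m}"
        using I ks(2) subset_tree_leaves_Node_iff[OF ts] by auto
      note C = contract_Node[OF ts I ks]
      have nonempty: "?c I k \<noteq> None" if "k \<in> set ks" for k
        using that ks(2) by (auto simp: branch_support_def)
      have inA: "I \<in> (\<Union>ks\<in>increasing_indices ?m ?r. A ks) \<longleftrightarrow>
          length ks = ?r \<and> (\<forall>j<?r. ?c I (ks ! j) = Some (ss ! j))"
      proof
        assume "I \<in> (\<Union>ks\<in>increasing_indices ?m ?r. A ks)"
        then obtain ls where ls: "ls \<in> increasing_indices ?m ?r" "I \<in> A ls" by blast
        then have "sorted_wrt (<) ls" "set ls = set ks"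
          using ks(2) unfolding increasing_indices_def A_def by blast+
        then have "ls = ks"
          using strict_sorted_equal[of ls ks] ks(1) by simp
        with ls show "length ks = ?r \<and> (\<forall>j<?r. ?c I (ks ! j) = Some (ss ! j))"
          by (auto simp: increasing_indices_def A_def simp del: contract.simps)
      next
        assume "length ks = ?r \<and> (\<forall>j<?r. ?c I (ks ! j) = Some (ss ! j))"
        then have "ks \<in> increasing_indices ?m ?r" "I \<in> A ks"
          using ks sub I by (auto simp: increasing_indices_def A_def simp del: contract.simps)
        then show "I \<in> (\<Union>ks\<in>increasing_indices ?m ?r. A ks)" by blast
      qed
      have inB: "I \<in> (\<Union>k<?m. B k) \<longleftrightarrow> (\<exists>k. ks = [k] \<and> ?c I k = Some (Node ss))"
      proof
        assume "I \<in> (\<Union>k<?m. B k)"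
        then obtain k where k: "k < ?m" "I \<in> B k" by blast
        then have "ks = [k]" by (simp add: ks_def B_def)
        with k show "\<exists>k. ks = [k] \<and> ?c I k = Some (Node ss)"
          by (auto simp: B_def simp del: contract.simps)
      next
        assume "\<exists>k. ks = [k] \<and> ?c I k = Some (Node ss)"
        then show "I \<in> (\<Union>k<?m. B k)"
          using ks(2) sub I by (auto simp: B_def simp del: contract.simps)
      qed
      consider "ks = []" | k where "ks = [k]" | "ks \<noteq> []" "length ks \<noteq> 1"
        by (metis One_nat_def length_0_conv length_Suc_conv)
      then show ?thesis
      proof cases
        \<comment> \<open>An empty support contracts to \<open>None\<close>, and neither
          \<open>A\<close> nor \<open>B\<close> admits it, since \<open>?r\<close> is at least
          2.\<close>
        case 1
        then show ?thesis using C ss I inA inB by auto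
      next
        case 2
        then show ?thesis unfolding Un_iff inA inB using C ss I by (auto simp del: contract.simps)
      next
        case 3
        \<comment> \<open>The root survives, so the planar trees agree exactly when their lists of
          children do. By \<open>nonempty\<close>, the comparison under \<open>the\<close> is then
          one of contractions, entry by entry.\<close>
        have "I \<in> ?E \<longleftrightarrow> map (\<lambda>k. the (?c I k)) ks = ss"
          using C 3 I by (simp del: contract.simps)
        also have "\<dots> \<longleftrightarrow> length ks = ?r \<and> (\<forall>j<?r. ?c I (ks ! j) = Some (ss ! j))"
          using nonempty[OF nth_mem] unfolding list_eq_iff_nth_eq
          by (metis (no_types, lifting) length_map nth_map option.collapse option.sel)
        finally show ?thesis unfolding Un_iff inA inB using 3 by auto
      qed
    qed
  qed
  have "pbinom (Some (Node ts)) (Some (Node ss)) = card ?E"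
    by (rule pbinom_Some_eq)
  also have "\<dots> = card (\<Union>ks\<in>increasing_indices ?m ?r. A ks) + card (\<Union>k<?m. B k)"
    unfolding E_eq
  proof (rule card_Un_disjoint)
    \<comment> \<open>This is where \<open>length ss \<ge> 2\<close> separates the two sums: the
      supports in \<open>A ks\<close> have \<open>?r\<close> elements, those in \<open>B k\<close>
      only one.\<close>
    have "set ks \<noteq> {k}" if "ks \<in> increasing_indices ?m ?r" for ks k
    proof
      assume "set ks = {k}"
      moreover have "card (set ks) = ?r"
        using that by (auto simp: increasing_indices_def strict_sorted_iff distinct_card)
      ultimately show False using ss by simp
    qed
    then have "A ks \<inter> B k = {}" if "ks \<in> increasing_indices ?m ?r" for ks k
      using that by (simp add: A_def B_def disjoint_iff)
    then show "(\<Union>ks\<in>increasing_indices ?m ?r. A ks) \<inter> (\<Union>k<?m. B k) = {}"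
      by blast
  qed (use finA finB finite_increasing_indices in auto)
  also have "card (\<Union>ks\<in>increasing_indices ?m ?r. A ks) =
      (\<Sum>ks\<in>increasing_indices ?m ?r. card (A ks))"
  proof (rule card_UN_disjoint)
    show "\<forall>ks\<in>increasing_indices ?m ?r. \<forall>ls\<in>increasing_indices ?m ?r.
        ks \<noteq> ls \<longrightarrow> A ks \<inter> A ls = {}"
    proof (intro ballI impI)
      fix ks ls
      assume "ks \<in> increasing_indices ?m ?r" "ls \<in> increasing_indices ?m ?r" "ks \<noteq> ls"
      \<comment> \<open>A strictly increasing list is determined by its set, and all members of
        \<open>A ks\<close> have support \<open>set ks\<close>.\<close>
      then have "set ks \<noteq> set ls"
        using strict_sorted_equal by (auto simp: increasing_indices_def)
      then show "A ks \<inter> A ls = {}"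
        by (auto simp: A_def simp del: contract.simps)
    qed
  qed (use finA finite_increasing_indices in auto)
  also have "card (\<Union>k<?m. B k) = (\<Sum>k<?m. card (B k))"
    using finB by (intro card_UN_disjoint) (auto simp: B_def simp del: contract.simps)
  finally show ?thesis
    by (simp add: card_A card_B)
qed

section \<open>Passage from index lists to increasing index functions\<close>

lemma bij_betw_strict_mono_increasing_indices:
  "bij_betw (\<lambda>i. map (\<lambda>j. i (Suc j) - 1) [0..<r])
     {i \<in> {1..r} \<rightarrow>\<^sub>E {1..m}. strict_mono_on {1..r} i} (increasing_indices m r)"
  (is "bij_betw ?f ?M _")
\<comment> \<open>Index functions take arguments and values from 1, while list positions and entries
  start at 0, so both are shifted by one. The witness is restricted to \<open>{1..r}\<close> because
  the functions are extensional.\<close>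
proof (rule bij_betw_byWitness[where f' = "\<lambda>ks. \<lambda>j\<in>{1..r}. Suc (ks ! (j - 1))"])
  \<comment> \<open>Positivity makes the truncated subtraction \<open>i j - 1\<close> invertible by
    \<open>Suc\<close> and keeps it strictly monotone.\<close>
  have pos: "0 < i j" if "i \<in> ?M" "j \<in> {1..r}" for i j
    using that PiE_mem[of i "{1..r}" "\<lambda>_. {1..m}" j] by simp
  show "\<forall>i\<in>?M. (\<lambda>j\<in>{1..r}. Suc (?f i ! (j - 1))) = i"
  proof
    fix i assume i: "i \<in> ?M"
    show "(\<lambda>j\<in>{1..r}. Suc (?f i ! (j - 1))) = i"
    proof
      fix j show "(\<lambda>j\<in>{1..r}. Suc (?f i ! (j - 1))) j = i j"
        using i pos[OF i, of j] by (cases "j \<in> {1..r}") (auto simp: PiE_def extensional_def)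
    qed
  qed
  show "\<forall>ks\<in>increasing_indices m r. ?f (\<lambda>j\<in>{1..r}. Suc (ks ! (j - 1))) = ks"
    by (auto simp: increasing_indices_def intro!: nth_equalityI)
  show "?f ` ?M \<subseteq> increasing_indices m r"
  proof
    fix ks assume "ks \<in> ?f ` ?M"
    then obtain i where i: "i \<in> ?M" and ks: "ks = ?f i" by blast
    have "i (Suc a) - 1 < i (Suc b) - 1" if "a < b" "b < r" for a b
    proof -
      have "i (Suc a) < i (Suc b)"
        using i that strict_mono_onD[of "{1..r}" i "Suc a" "Suc b"] by simp
      then show ?thesis using pos[OF i, of "Suc a"] that by simp
    qed
    moreover have "i (Suc a) - 1 < m" if "a < r" for a
      using i that PiE_mem[of i "{1..r}" "\<lambda>_. {1..m}" "Suc a"] by fastforce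
    ultimately show "ks \<in> increasing_indices m r"
      by (auto simp: ks increasing_indices_def sorted_wrt_iff_nth_less)
  qed
  show "(\<lambda>ks. \<lambda>j\<in>{1..r}. Suc (ks ! (j - 1))) ` increasing_indices m r \<subseteq> ?M"
  proof
    fix i assume "i \<in> (\<lambda>ks. \<lambda>j\<in>{1..r}. Suc (ks ! (j - 1))) ` increasing_indices m r"
    then obtain ks where ks: "ks \<in> increasing_indices m r"
      and i: "i = (\<lambda>j\<in>{1..r}. Suc (ks ! (j - 1)))" by blast
    have "ks ! (j - 1) < m" if "j \<in> {1..r}" for j
    proof -
      have "ks ! (j - 1) \<in> set ks"
        using ks that by (intro nth_mem) (auto simp: increasing_indices_def)
      then show ?thesis using ks by (auto simp: increasing_indices_def)
    qed
    then have "i \<in> {1..r} \<rightarrow>\<^sub>E {1..m}"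
      by (auto simp: i Suc_le_eq)
    moreover have "strict_mono_on {1..r} i"
      using ks by (auto simp: i increasing_indices_def sorted_wrt_iff_nth_less intro!: strict_mono_onI)
    ultimately show "i \<in> ?M" by blast
  qed
qed

theorem proposition2p3:
  fixes m r :: nat
    and T S :: "ptree option"
    and Ts Ss :: "nat \<Rightarrow> ptree option"
  assumes "m \<ge> 2" and "r \<ge> 2"
    and "\<forall>i\<in>{1..m}. Ts i \<in> planar_trees - {empty_tree}"
    and "\<forall>j\<in>{1..r}. Ss j \<in> planar_trees - {empty_tree}"
    and "T = graft (map Ts [1..<m + 1])"
    and "S = graft (map Ss [1..<r + 1])"
  shows "pbinom T S =
    (\<Sum>i \<in> {i \<in> {1..r} \<rightarrow>\<^sub>E {1..m}. strict_mono_on {1..r} i}.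
       \<Prod>j = 1..r. pbinom (Ts (i j)) (Ss j))
    + (\<Sum>i = 1..m. pbinom (Ts i) S)"
proof -
  let ?M = "{i \<in> {1..r} \<rightarrow>\<^sub>E {1..m}. strict_mono_on {1..r} i}"
  define ts where "ts = map (the \<circ> Ts) [1..<m + 1]"
  define ss where "ss = map (the \<circ> Ss) [1..<r + 1]"
  have T: "T = Some (Node ts)" and S: "S = Some (Node ss)"
    using assms(5,6) by (simp_all add: graft_def ts_def ss_def)
  have len: "length ts = m" "length ss = r"
    by (simp_all add: ts_def ss_def)
  \<comment> \<open>Since no \<open>Ts k\<close> is the empty tree, \<open>the\<close> is undone by
    \<open>Some\<close>; the offset passes from indices from 1 to list positions.\<close>
  have ts_nth: "Some (ts ! (k - 1)) = Ts k" if "k \<in> {1..m}" for k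
    using that assms(3) by (auto simp: ts_def nth_append simp del: upt_Suc)
  have ss_nth: "Some (ss ! (k - 1)) = Ss k" if "k \<in> {1..r}" for k
    using that assms(4) by (auto simp: ss_def nth_append simp del: upt_Suc)
  have shift: "bij_betw Suc {..<n} {1..n}" for n
    by (rule bij_betwI[where g = "\<lambda>k. k - 1"]) auto
  \<comment> \<open>The sum is moved to index functions first; the range of the inner product is
    shifted afterwards by \<open>shift\<close>.\<close>
  have "(\<Sum>ks \<in> increasing_indices m r. \<Prod>j<r. pbinom (Some (ts ! (ks ! j))) (Some (ss ! j)))
    = (\<Sum>i\<in>?M. \<Prod>j<r. pbinom (Some (ts ! (i (Suc j) - 1))) (Some (ss ! j)))"
    by (subst sum.reindex_bij_betw[OF bij_betw_strict_mono_increasing_indices, symmetric]) simp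
  also have "\<dots> = (\<Sum>i\<in>?M. \<Prod>j<r. pbinom (Ts (i (Suc j))) (Ss (Suc j)))"
  proof (intro sum.cong prod.cong refl)
    fix i j assume "i \<in> ?M" "j \<in> {..<r}"
    then have "i (Suc j) \<in> {1..m}" "Suc j \<in> {1..r}"
      using PiE_mem[of i "{1..r}" "\<lambda>_. {1..m}" "Suc j"] by simp_all
    then show "pbinom (Some (ts ! (i (Suc j) - 1))) (Some (ss ! j))
        = pbinom (Ts (i (Suc j))) (Ss (Suc j))"
      using ts_nth[of "i (Suc j)"] ss_nth[of "Suc j"] by simp
  qed
  also have "\<dots> = (\<Sum>i\<in>?M. \<Prod>j = 1..r. pbinom (Ts (i j)) (Ss j))"
    by (intro sum.cong refl prod.reindex_bij_betw[OF shift])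
  finally have A: "(\<Sum>ks \<in> increasing_indices m r.
      \<Prod>j<r. pbinom (Some (ts ! (ks ! j))) (Some (ss ! j)))
    = (\<Sum>i\<in>?M. \<Prod>j = 1..r. pbinom (Ts (i j)) (Ss j))" .
  have "(\<Sum>k<m. pbinom (Some (ts ! k)) S) = (\<Sum>k<m. pbinom (Ts (Suc k)) S)"
    using ts_nth[of "Suc k" for k] by (intro sum.cong) auto
  also have "\<dots> = (\<Sum>i = 1..m. pbinom (Ts i) S)"
    by (rule sum.reindex_bij_betw[OF shift])
  finally show ?thesis
    using pbinom_Node_Node[of ts ss] A assms(1,2) len unfolding T S by force
qed

end
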